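(* Let $I\subseteq\mathbb{R}$ be an open invex subset with respect to $\eta:I\times I\to\mathbb{R}_+$, let $f:I\to\mathbb{R}$ be an absolutely continuous mapping on $I$, and let $a,b\in I$ with $\eta(b,a)\neq 0$. Let $q\ge1$ be fixed. If $|f'|^q$ is prequasiinvex on $I$ with respect to $\eta$, then $$\left|\frac{1}{6}\left[f(a)+4f\left(\frac{2a+\eta(b,a)}{2}\right)+f(a+\eta(b,a))\right]-\frac{1}{\eta(b,a)}\int_a^{a+\eta(b,a)}f(x)\,dx\right|\le\frac{5}{36}\,\eta(b,a)\left[\max\left\{|f'(a)|^q,|f'(b)|^q\right\}\right]^{\frac1q}.$$
   Context: $\mathbb{R}_+=[0,\infty)$. A set $I\subseteq\mathbb{R}$ is invex with respect to $\eta:I\times I\to\mathbb{R}_+$ if $u+t\,\eta(v,u)\in I$ for all $u,v\in I$ and all $t\in[0,1]$. A function $g:I\to\mathbb{R}$ on an invex set $I$ is prequasiinvex with respect to $\eta$ if $g(u+t\,\eta(v,u))\le\max\{g(u),g(v)\}$ for all $u,v\in I$, $t\in[0,1]$. $f'$ is the derivative of $f$; the hypothesis that $|f'|^q$ is prequasiinvex on $I$ presupposes that $f'(x)$ exists at every $x\in I$. *)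

theory Defs
  imports "HOL-Analysis.Analysis"
begin

text \<open>
  The map \<open>\<eta>\<close> is a total function of which only the values on \<open>I \<times> I\<close> are
  constrained; that it takes nonnegative values there is part of the definition.
\<close>

definition invex :: "real set \<Rightarrow> (real \<Rightarrow> real \<Rightarrow> real) \<Rightarrow> bool" where
  "invex I \<eta> \<longleftrightarrow>
     (\<forall>u\<in>I. \<forall>v\<in>I. 0 \<le> \<eta> v u \<and> (\<forall>t\<in>{0..1}. u + t * \<eta> v u \<in> I))"

definition prequasiinvex_on ::
    "real set \<Rightarrow> (real \<Rightarrow> real \<Rightarrow> real) \<Rightarrow> (real \<Rightarrow> real) \<Rightarrow> bool" where
  "prequasiinvex_on I \<eta> g \<longleftrightarrow>
     (\<forall>u\<in>I. \<forall>v\<in>I. \<forall>t\<in>{0..1}. g (u + t * \<eta> v u) \<le> max (g u) (g v))"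

text \<open>
  The classical \<open>\<epsilon>\<close>-\<open>\<delta>\<close> notion for real functions, unrelated to absolute continuity of
  measures (\<open>absolutely_continuous\<close>). An open invex set need not be an interval, so the
  definition requires each closed interval \<open>{l i..r i}\<close> to lie within \<open>I\<close>, not only its
  end points.
\<close>

definition absolutely_continuous_on :: "real set \<Rightarrow> (real \<Rightarrow> real) \<Rightarrow> bool" where
  "absolutely_continuous_on I f \<longleftrightarrow>
     (\<forall>\<epsilon>>0. \<exists>\<delta>>0. \<forall>(n::nat) l r.
        (\<forall>i<n. l i \<le> r i \<and> {l i..r i} \<subseteq> I) \<and>
        disjoint_family_on (\<lambda>i. {l i<..<r i}) {..<n} \<and>
        (\<Sum>i<n. r i - l i) < \<delta>
        \<longrightarrow> (\<Sum>i<n. \<bar>f (r i) - f (l i)\<bar>) < \<epsilon>)"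

end

theory Submission
  imports Defs
begin

text \<open>
  The bound comes from a Lipschitz estimate for \<open>f\<close>. Put \<open>c = a + \<eta> b a\<close> and let \<open>M\<close> be the \<open>q\<close>-th root
  of the maximum on the right. Every point of \<open>[a, c]\<close> has the form \<open>a + t * \<eta> b a\<close>, so
  prequasiinvexity gives \<open>\<bar>f'\<bar> \<le> M\<close> there, and by the mean value theorem \<open>f\<close> is
  \<open>M\<close>-Lipschitz on \<open>[a, c]\<close>.

  The Simpson weights \<open>1/6\<close>, \<open>4/6\<close>, \<open>1/6\<close> are the relative lengths of the pieces into which
  \<open>(5 a + c)/6\<close> and \<open>(a + 5 c)/6\<close> cut \<open>[a, c]\<close>. Simpson's rule is therefore the sum of three
  one-point rules: the left piece is sampled at its left end, the middle piece at its
  midpoint, the right piece at its right end. By the Ostrowski inequality a one-point rule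
  errs by at most \<open>M\<close> times the integral of the distance to the node. With \<open>h = c - a\<close>, the
  two outer pieces contribute \<open>M h\<^sup>2/72\<close> each and the two halves of the middle piece
  \<open>M h\<^sup>2/18\<close> each; the total is \<open>5/36 * M * h\<^sup>2\<close>, and division by \<open>h\<close> gives the claim.
\<close>

lemma has_integral_dist_to_node:
  fixes l x r :: real
  assumes "l \<le> x" "x \<le> r"
  shows "((\<lambda>y. \<bar>y - x\<bar>) has_integral ((x - l)\<^sup>2 + (r - x)\<^sup>2) / 2) {l..r}"
proof -
  have "((\<lambda>y. x - y) has_integral (- (x - x)\<^sup>2 / 2 - (- (x - l)\<^sup>2 / 2))) {l..x}"
    by (rule fundamental_theorem_of_calculus[OF assms(1)])
      (auto intro!: derivative_eq_intros simp: field_simps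
        simp flip: has_real_derivative_iff_has_vector_derivative)
  then have left: "((\<lambda>y. \<bar>y - x\<bar>) has_integral (x - l)\<^sup>2 / 2) {l..x}"
    by (auto intro: has_integral_eq[rotated])
  have "((\<lambda>y. y - x) has_integral ((r - x)\<^sup>2 / 2 - (x - x)\<^sup>2 / 2)) {x..r}"
    by (rule fundamental_theorem_of_calculus[OF assms(2)])
      (auto intro!: derivative_eq_intros simp flip: has_real_derivative_iff_has_vector_derivative)
  then have right: "((\<lambda>y. \<bar>y - x\<bar>) has_integral (r - x)\<^sup>2 / 2) {x..r}"
    by (auto intro: has_integral_eq[rotated])
  show ?thesis
    using has_integral_combine[OF assms left right] by (simp add: add_divide_distrib)
qed

text \<open>
  The Ostrowski inequality: integrate \<open>\<bar>f y - f x\<bar> \<le> M * \<bar>y - x\<bar>\<close> over \<open>y\<close>.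
\<close>

lemma ostrowski_lipschitz:
  fixes f :: "real \<Rightarrow> real"
  assumes lip: "M-lipschitz_on {l..r} f" and x: "l \<le> x" "x \<le> r"
  shows "\<bar>integral {l..r} f - (r - l) * f x\<bar> \<le> M * (((x - l)\<^sup>2 + (r - x)\<^sup>2) / 2)"
proof -
  have f_int: "(f has_integral integral {l..r} f) {l..r}"
    by (intro integrable_integral integrable_continuous_real lipschitz_on_continuous_on[OF lip])
  have const_int: "((\<lambda>y. f x) has_integral (r - l) * f x) {l..r}"
    using has_integral_const_real[of "f x" l r] x by simp
  have diff_int: "((\<lambda>y. f y - f x) has_integral integral {l..r} f - (r - l) * f x) {l..r}"
    by (rule has_integral_diff[OF f_int const_int])
  have bound_int: "((\<lambda>y. M * \<bar>y - x\<bar>) has_integral M * (((x - l)\<^sup>2 + (r - x)\<^sup>2) / 2)) {l..r}"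
    by (rule has_integral_mult_right[OF has_integral_dist_to_node[OF x]])
  have "norm (f y - f x) \<le> M * \<bar>y - x\<bar>" if "y \<in> {l..r}" for y
    using lipschitz_onD[OF lip that, of x] x by (simp add: dist_real_def)
  then have "norm (integral {l..r} (\<lambda>y. f y - f x)) \<le> integral {l..r} (\<lambda>y. M * \<bar>y - x\<bar>)"
    using diff_int bound_int by (intro integral_norm_bound_integral) auto
  then show ?thesis
    unfolding integral_unique[OF diff_int] integral_unique[OF bound_int] by simp
qed

lemma simpson_lipschitz:
  fixes f :: "real \<Rightarrow> real"
  assumes lip: "M-lipschitz_on {a..c} f" and "a < c"
  shows "\<bar>1 / 6 * (f a + 4 * f ((a + c) / 2) + f c) - 1 / (c - a) * integral {a..c} f\<bar>
         \<le> 5 / 36 * (c - a) * M"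
proof -
  define h where "h = c - a"
  have h: "h > 0" and c: "c = a + h"
    using \<open>a < c\<close> by (simp_all add: h_def)
  \<comment> \<open>The lengths of \<open>[a, p]\<close>, \<open>[p, s]\<close>, \<open>[s, c]\<close> are \<open>h\<close> times the Simpson weights.\<close>
  define p s where "p = a + h / 6" and "s = a + 5 * h / 6"
  have order: "a \<le> p" "p \<le> s" "s \<le> c" "a \<le> s"
    using h by (simp_all add: p_def s_def c)
  have f_int: "f integrable_on {a..c}"
    by (intro integrable_continuous_real lipschitz_on_continuous_on[OF lip])
  have f_int': "f integrable_on {a..s}"
    using integrable_on_subinterval[OF f_int] order by auto
  have split: "integral {a..c} f = integral {a..p} f + integral {p..s} f + integral {s..c} f"
    using Henstock_Kurzweil_Integration.integral_combine[OF order(4,3) f_int]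
      Henstock_Kurzweil_Integration.integral_combine[OF order(1,2) f_int'] by simp
  have left: "\<bar>integral {a..p} f - h / 6 * f a\<bar> \<le> M * (h\<^sup>2 / 72)"
    using ostrowski_lipschitz[OF lipschitz_on_subset[OF lip, of "{a..p}"], of a] order
    by (simp add: p_def power_divide)
  have mid: "\<bar>integral {p..s} f - 4 * h / 6 * f ((a + c) / 2)\<bar> \<le> M * (h\<^sup>2 / 9)"
  proof -
    have sides: "s - p = 4 * h / 6" "(a + c) / 2 - p = h / 3" "s - (a + c) / 2 = h / 3"
      by (simp_all add: p_def s_def c field_simps)
    have "p \<le> (a + c) / 2" "(a + c) / 2 \<le> s"
      using sides h by linarith+
    then have "\<bar>integral {p..s} f - (s - p) * f ((a + c) / 2)\<bar>
        \<le> M * ((((a + c) / 2 - p)\<^sup>2 + (s - (a + c) / 2)\<^sup>2) / 2)"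
      using order
      by (intro ostrowski_lipschitz lipschitz_on_subset[OF lip]) auto
    then show ?thesis
      unfolding sides by (simp add: power_divide)
  qed
  have right: "\<bar>integral {s..c} f - h / 6 * f c\<bar> \<le> M * (h\<^sup>2 / 72)"
  proof -
    have len: "c - s = h / 6"
      by (simp add: s_def c)
    have "\<bar>integral {s..c} f - (c - s) * f c\<bar> \<le> M * (((c - s)\<^sup>2 + (c - c)\<^sup>2) / 2)"
      using order by (intro ostrowski_lipschitz lipschitz_on_subset[OF lip]) auto
    then show ?thesis
      unfolding len by (simp add: power_divide)
  qed
  let ?S = "1 / 6 * (f a + 4 * f ((a + c) / 2) + f c)"
  have "\<bar>h * ?S - integral {a..c} f\<bar>
      \<le> M * (h\<^sup>2 / 72) + M * (h\<^sup>2 / 9) + M * (h\<^sup>2 / 72)"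
  proof -
    have "h * ?S = h / 6 * f a + 4 * h / 6 * f ((a + c) / 2) + h / 6 * f c"
      by (simp add: algebra_simps)
    then show ?thesis
      using left mid right unfolding split by linarith
  qed
  also have "\<dots> = h * (5 / 36 * h * M)"
    by (simp add: power2_eq_square)
  finally have "\<bar>h * ?S - integral {a..c} f\<bar> / h \<le> 5 / 36 * h * M"
    using h by (simp add: pos_divide_le_eq mult.commute)
  moreover have "\<bar>h * ?S - integral {a..c} f\<bar> / h = \<bar>?S - 1 / h * integral {a..c} f\<bar>"
  proof -
    have "?S - 1 / h * integral {a..c} f = (h * ?S - integral {a..c} f) / h"
      using h by (simp add: diff_divide_distrib)
    then show ?thesis
      using h by simp
  qed
  ultimately show ?thesis
    by (simp only: h_def)
qed

theorem theorem5:
  fixes I :: "real set" and \<eta> :: "real \<Rightarrow> real \<Rightarrow> real"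
    and f f' :: "real \<Rightarrow> real" and a b q :: real
  assumes "open I" and "invex I \<eta>"
    and "absolutely_continuous_on I f"
    and "a \<in> I" and "b \<in> I" and "\<eta> b a \<noteq> 0"
    and "q \<ge> 1"
    and "\<And>x. x \<in> I \<Longrightarrow> (f has_real_derivative f' x) (at x)"
    and "prequasiinvex_on I \<eta> (\<lambda>x. \<bar>f' x\<bar> powr q)"
  shows "\<bar>1 / 6 * (f a + 4 * f ((2 * a + \<eta> b a) / 2) + f (a + \<eta> b a))
           - 1 / \<eta> b a * integral {a..a + \<eta> b a} f\<bar>
         \<le> 5 / 36 * \<eta> b a * (max (\<bar>f' a\<bar> powr q) (\<bar>f' b\<bar> powr q)) powr (1 / q)"
proof -
  define h M where "h = \<eta> b a"
    and "M = (max (\<bar>f' a\<bar> powr q) (\<bar>f' b\<bar> powr q)) powr (1 / q)"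
  have h: "h > 0"
    using assms(2,4,5,6) by (force simp: invex_def h_def)
  have deriv: "(f has_real_derivative f' x) (at x within {a..a + h}) \<and> \<bar>f' x\<bar> \<le> M"
    if x: "x \<in> {a..a + h}" for x
  proof -
    define t where "t = (x - a) / h"
    have t: "t \<in> {0..1}" and x_eq: "x = a + t * \<eta> b a"
      using x h by (auto simp: t_def h_def field_simps)
    have "x \<in> I"
      using assms(2,4,5) t x_eq by (simp add: invex_def)
    have "\<bar>f' x\<bar> powr q \<le> max (\<bar>f' a\<bar> powr q) (\<bar>f' b\<bar> powr q)"
      using assms(4,5,9) t x_eq by (simp add: prequasiinvex_on_def)
    then have "(\<bar>f' x\<bar> powr q) powr (1 / q) \<le> M"
      using \<open>q \<ge> 1\<close> unfolding M_def by (intro powr_mono2) auto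
    then have "\<bar>f' x\<bar> \<le> M"
      using \<open>q \<ge> 1\<close> by (simp add: powr_powr)
    then show ?thesis
      using assms(8)[OF \<open>x \<in> I\<close>] by (blast intro: has_field_derivative_at_within)
  qed
  have "M-lipschitz_on {a..a + h} f"
  proof (rule lipschitz_onI)
    fix x y assume "x \<in> {a..a + h}" "y \<in> {a..a + h}"
    then show "dist (f x) (f y) \<le> M * dist x y"
      using field_differentiable_bound[of "{a..a + h}" f f' M x y] deriv
      by (simp add: dist_norm)
  qed (simp add: M_def)
  from simpson_lipschitz[OF this] h show ?thesis
    by (simp add: h_def M_def)
qed

end
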